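(* Let $G$ be a discrete group and $H$ and $K$ be two distinct non-trivial subgroups of $G$. Then, in $L(G)$, the distances $$d_C(\mathbb{C}[H],\mathbb{C}[K]),\quad d_{MT}(\mathbb{C}[H],\mathbb{C}[K]),\quad d_{KK}(\mathbb{C}[H],\mathbb{C}[K]),$$ $$d_C(L(H),L(K)),\quad d_{MT}(L(H),L(K))\quad\text{and}\quad d_{KK}(L(H),L(K))$$ are all equal to $1$.
   Context: $L(G)=\lambda(G)''\subseteq B(\ell^2(G))$ is the group von Neumann algebra, $\lambda$ the left regular representation, with faithful normal tracial state $\tau(x)=\langle x\delta_e,\delta_e\rangle$ and $\|x\|_\tau=\tau(x^*x)^{1/2}$. $\mathbb{C}[G]$ is identified with the $*$-algebra generated by $\lambda(G)$; for a subgroup $H\le G$, $\mathbb{C}[H]$ and $L(H)\cong\lambda(H)''$ are regarded as subalgebras of $L(G)$. For subalgebras $P,Q$ of $L(G)$, $B_1(P)$ denotes the closed unit ball with respect to the operator norm, and: - $d_{KK}(P,Q)=\max\{\sup_{x\in B_1(P)}\inf_{y\in B_1(Q)}\|x-y\|,\ \sup_{y\in B_1(Q)}\inf_{x\in B_1(P)}\|x-y\|\}$ (Kadison-Kastler distance, operator norm); - $d_{MT}(P,Q)$ (Mashood-Taylor distance) is the same expression with $\|x-y\|$ replaced by $\|x-y\|_\tau$; - $d_C(P,Q)=\inf\{\gamma>0:P\subset_\gamma Q\text{ and }Q\subset_\gamma P\}$ (Christensen distance), where $P\subset_\gamma Q$ means that for each $x\in B_1(P)$ there is $y\in Q$ with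 $\|x-y\|_\tau\le\gamma$. *)

theory Defs
  imports "HOL-Analysis.Analysis" "HOL-Algebra.Group"
begin

text \<open>
  The Hilbert space $\ell^2(I)$ over an index set \<open>I\<close> consists of functions on the whole type that
  vanish off \<open>I\<close>, so equality of vectors is equality of functions and sums can range over the type.
\<close>

definition ell2 :: "'a set \<Rightarrow> ('a \<Rightarrow> complex) set" where
  "ell2 I = {f. (\<lambda>x. (cmod (f x))\<^sup>2) summable_on UNIV \<and> (\<forall>x. x \<notin> I \<longrightarrow> f x = 0)}"

definition ell2_inner :: "('a \<Rightarrow> complex) \<Rightarrow> ('a \<Rightarrow> complex) \<Rightarrow> complex" where
  "ell2_inner f g = (\<Sum>\<^sub>\<infinity>x. f x * cnj (g x))"

definition ell2_norm :: "('a \<Rightarrow> complex) \<Rightarrow> real" where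
  "ell2_norm f = sqrt (\<Sum>\<^sub>\<infinity>x. (cmod (f x))\<^sup>2)"

definition ell2_delta :: "'a \<Rightarrow> ('a \<Rightarrow> complex)" where
  "ell2_delta a = (\<lambda>x. if x = a then 1 else 0)"

type_synonym 'a operator = "('a \<Rightarrow> complex) \<Rightarrow> ('a \<Rightarrow> complex)"

definition op_add :: "'a operator \<Rightarrow> 'a operator \<Rightarrow> 'a operator" where
  "op_add S T = (\<lambda>f x. S f x + T f x)"

definition op_diff :: "'a operator \<Rightarrow> 'a operator \<Rightarrow> 'a operator" where
  "op_diff S T = (\<lambda>f x. S f x - T f x)"

definition op_scale :: "complex \<Rightarrow> 'a operator \<Rightarrow> 'a operator" where
  "op_scale c T = (\<lambda>f x. c * T f x)"

definition op_zero :: "'a operator" where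
  "op_zero = (\<lambda>f x. 0)"

text \<open>
  $B(\ell^2(I))$: the complex-linear bounded operators. They are normalised to be zero outside
  $\ell^2(I)$, so that equality of operators is equality of functions.
\<close>

definition bounded_ops :: "'a set \<Rightarrow> 'a operator set" where
  "bounded_ops I = {T.
     (\<forall>f. f \<notin> ell2 I \<longrightarrow> T f = (\<lambda>x. 0)) \<and>
     (\<forall>f\<in>ell2 I. T f \<in> ell2 I) \<and>
     (\<forall>f\<in>ell2 I. \<forall>g\<in>ell2 I. T (\<lambda>x. f x + g x) = (\<lambda>x. T f x + T g x)) \<and>
     (\<forall>c. \<forall>f\<in>ell2 I. T (\<lambda>x. c * f x) = (\<lambda>x. c * T f x)) \<and>
     (\<exists>C. \<forall>f\<in>ell2 I. ell2_norm (T f) \<le> C * ell2_norm f)}"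

definition op_norm :: "'a set \<Rightarrow> 'a operator \<Rightarrow> real" where
  "op_norm I T = (SUP f \<in> {f \<in> ell2 I. ell2_norm f \<le> 1}. ell2_norm (T f))"

definition op_adj :: "'a set \<Rightarrow> 'a operator \<Rightarrow> 'a operator" where
  "op_adj I T = (THE S. S \<in> bounded_ops I \<and>
     (\<forall>f\<in>ell2 I. \<forall>g\<in>ell2 I. ell2_inner (T f) g = ell2_inner f (S g)))"

definition commutant :: "'a set \<Rightarrow> 'a operator set \<Rightarrow> 'a operator set" where
  "commutant I A = {T \<in> bounded_ops I. \<forall>S\<in>A. T \<circ> S = S \<circ> T}"

definition star_subalgebra :: "'a set \<Rightarrow> 'a operator set \<Rightarrow> bool" where
  "star_subalgebra I A \<longleftrightarrow> A \<subseteq> bounded_ops I \<and> op_zero \<in> A \<and>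
     (\<forall>S\<in>A. \<forall>T\<in>A. op_add S T \<in> A) \<and> (\<forall>c. \<forall>T\<in>A. op_scale c T \<in> A) \<and>
     (\<forall>S\<in>A. \<forall>T\<in>A. S \<circ> T \<in> A) \<and> (\<forall>T\<in>A. op_adj I T \<in> A)"

definition star_algebra_generated :: "'a set \<Rightarrow> 'a operator set \<Rightarrow> 'a operator set" where
  "star_algebra_generated I S = \<Inter>{A. star_subalgebra I A \<and> S \<subseteq> A}"

definition left_regular :: "('a, 'b) monoid_scheme \<Rightarrow> 'a \<Rightarrow> 'a operator" where
  "left_regular G g = (\<lambda>f. if f \<in> ell2 (carrier G)
     then (\<lambda>x. if x \<in> carrier G then f (inv\<^bsub>G\<^esub> g \<otimes>\<^bsub>G\<^esub> x) else 0)
     else (\<lambda>x. 0))"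

text \<open>
  For a subgroup \<open>H\<close> of \<open>G\<close>, both the group algebra and the group von Neumann algebra of \<open>H\<close> are
  taken inside $B(\ell^2(G))$, via the restriction to \<open>H\<close> of the left regular representation of \<open>G\<close>;
  \<open>group_vN G (carrier G)\<close> is $L(G)$.
\<close>

definition group_alg :: "('a, 'b) monoid_scheme \<Rightarrow> 'a set \<Rightarrow> 'a operator set" where
  "group_alg G H = star_algebra_generated (carrier G) (left_regular G ` H)"

definition group_vN :: "('a, 'b) monoid_scheme \<Rightarrow> 'a set \<Rightarrow> 'a operator set" where
  "group_vN G H = commutant (carrier G) (commutant (carrier G) (left_regular G ` H))"

definition group_trace :: "('a, 'b) monoid_scheme \<Rightarrow> 'a operator \<Rightarrow> complex" where
  "group_trace G T = ell2_inner (T (ell2_delta \<one>\<^bsub>G\<^esub>)) (ell2_delta \<one>\<^bsub>G\<^esub>)"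

definition tau_norm :: "('a, 'b) monoid_scheme \<Rightarrow> 'a operator \<Rightarrow> real" where
  "tau_norm G T = sqrt (Re (group_trace G (op_adj (carrier G) T \<circ> T)))"

definition unit_ball :: "('a, 'b) monoid_scheme \<Rightarrow> 'a operator set \<Rightarrow> 'a operator set" where
  "unit_ball G P = {T \<in> P. op_norm (carrier G) T \<le> 1}"

text \<open>
  For the algebras considered here, the real suprema and infima below are over nonempty bounded
  sets: each unit ball contains \<open>op_zero\<close>, so every inner infimum lies between 0 and 1.
\<close>

definition dist_KK :: "('a, 'b) monoid_scheme \<Rightarrow> 'a operator set \<Rightarrow> 'a operator set \<Rightarrow> real" where
  "dist_KK G P Q = max
     (SUP x\<in>unit_ball G P. INF y\<in>unit_ball G Q. op_norm (carrier G) (op_diff x y))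
     (SUP y\<in>unit_ball G Q. INF x\<in>unit_ball G P. op_norm (carrier G) (op_diff x y))"

definition dist_MT :: "('a, 'b) monoid_scheme \<Rightarrow> 'a operator set \<Rightarrow> 'a operator set \<Rightarrow> real" where
  "dist_MT G P Q = max
     (SUP x\<in>unit_ball G P. INF y\<in>unit_ball G Q. tau_norm G (op_diff x y))
     (SUP y\<in>unit_ball G Q. INF x\<in>unit_ball G P. tau_norm G (op_diff x y))"

definition near_contained ::
    "('a, 'b) monoid_scheme \<Rightarrow> real \<Rightarrow> 'a operator set \<Rightarrow> 'a operator set \<Rightarrow> bool" where
  "near_contained G \<gamma> P Q \<longleftrightarrow> (\<forall>x\<in>unit_ball G P. \<exists>y\<in>Q. tau_norm G (op_diff x y) \<le> \<gamma>)"

definition dist_C :: "('a, 'b) monoid_scheme \<Rightarrow> 'a operator set \<Rightarrow> 'a operator set \<Rightarrow> real" where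
  "dist_C G P Q = Inf {\<gamma>. \<gamma> > 0 \<and> near_contained G \<gamma> P Q \<and> near_contained G \<gamma> Q P}"

end

theory Submission
  imports Defs
begin

text \<open>
  Every element \<open>y\<close> of $\mathbb{C}[K]$ or $L(K)$ commutes with the projection onto $\ell^2(K)$, so
  $y\delta_e$ is supported on \<open>K\<close>. If $g \in H \setminus K$, then the unitary $\lambda(g)$ sends
  $\delta_e$ to $\delta_g$, which is at distance at least 1 from every such $y\delta_e$. As
  $\|x\|_\tau = \|x\delta_e\| \le \|x\|$, this bounds all distances below by 1, and comparing with
  \<open>0\<close> bounds them above by 1.
\<close>

section \<open>The Hilbert space of square-summable functions\<close>

text \<open>The commutant of the projection p onto the functions supported on K handles both kinds
  of algebra at once. It is a star-subalgebra containing \<lambda>(K), hence contains the algebra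
  generated by \<lambda>(K); and p commutes with \<lambda>(K), because left translation by K
  permutes K and its complement, hence the double commutant commutes with p. The distances can then
  be computed for arbitrary sets of operators lying between \<lambda>(K) with 0 adjoined and this
  commutant. The main labour is the adjoint: the trace norm and star-closure refer to
  \<open>op_adj\<close>, a definite description, so nothing can be said about them before adjoints
  are known to exist and to be unique. They are built from matrix coefficients. Two features of the
  definitions shape the lower bound. A suitable g may exist in only one of H - K and K - H, so both
  directions of each distance must be treated. And d_C admits approximants of any norm, so the
  estimate is needed for every y in the algebra, not just in its unit ball.\<close>

lemma ell2_summable: "f \<in> ell2 I \<Longrightarrow> (\<lambda>x. (cmod (f x))\<^sup>2) summable_on UNIV"
  by (simp add: ell2_def)

lemma ell2_outside: "f \<in> ell2 I \<Longrightarrow> x \<notin> I \<Longrightarrow> f x = 0"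
  by (simp add: ell2_def)

lemma ell2_norm_nonneg: "0 \<le> ell2_norm f"
  by (simp add: ell2_norm_def infsum_nonneg)

lemma ell2_norm_power2: "(ell2_norm f)\<^sup>2 = (\<Sum>\<^sub>\<infinity>x. (cmod (f x))\<^sup>2)"
  by (simp add: ell2_norm_def infsum_nonneg)

lemma L2_set_le_ell2_norm:
  assumes "f \<in> ell2 I" "finite F"
  shows "L2_set (\<lambda>x. cmod (f x)) F \<le> ell2_norm f"
  unfolding L2_set_def ell2_norm_def
  using assms by (intro real_sqrt_le_mono finite_sum_le_infsum) (auto simp: ell2_summable)

text \<open>A series of nonnegative terms is controlled by its finite partial sums. This lets the
  finite inequalities for \<open>L2_set\<close> (Minkowski, Cauchy-Schwarz) yield membership in
  \<open>ell2\<close> and a norm bound together.\<close>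

lemma ell2_boundedI:
  assumes "\<And>x. x \<notin> I \<Longrightarrow> f x = 0"
    and "\<And>F. finite F \<Longrightarrow> L2_set (\<lambda>x. cmod (f x)) F \<le> B"
  shows "f \<in> ell2 I" and "ell2_norm f \<le> B"
proof -
  \<comment> \<open>The empty set already forces the sign of B, which is needed to square the
    bound.\<close>
  have B: "0 \<le> B" using assms(2)[of "{}"] by simp
  have *: "(\<Sum>x\<in>F. (cmod (f x))\<^sup>2) \<le> B\<^sup>2" if "finite F" for F
    using assms(2)[OF that] B unfolding L2_set_def by (simp add: real_sqrt_le_iff' sum_nonneg)
  have s: "(\<lambda>x. (cmod (f x))\<^sup>2) summable_on UNIV"
    by (rule nonneg_bdd_above_summable_on) (auto intro!: bdd_aboveI[where M="B\<^sup>2"] *)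
  show "f \<in> ell2 I" using s assms(1) by (simp add: ell2_def)
  have "(\<Sum>\<^sub>\<infinity>x. (cmod (f x))\<^sup>2) \<le> B\<^sup>2"
    by (rule infsum_le_finite_sums[OF s]) (use * in auto)
  then show "ell2_norm f \<le> B"
    unfolding ell2_norm_def using B by (simp add: real_le_lsqrt)
qed

lemma cmod_le_ell2_norm:
  assumes "f \<in> ell2 I"
  shows "cmod (f x) \<le> ell2_norm f"
  using L2_set_le_ell2_norm[OF assms, of "{x}"] by (simp add: L2_set_def)

lemma ell2_zero: "(\<lambda>x. 0) \<in> ell2 I" and ell2_norm_zero: "ell2_norm (\<lambda>x. 0) = 0"
  by (auto simp: ell2_def ell2_norm_def)

lemma
  assumes "f \<in> ell2 I" "g \<in> ell2 I"
  shows ell2_add: "(\<lambda>x. f x + g x) \<in> ell2 I"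
    and ell2_norm_triangle: "ell2_norm (\<lambda>x. f x + g x) \<le> ell2_norm f + ell2_norm g"
proof -
  have *: "L2_set (\<lambda>x. cmod (f x + g x)) F \<le> ell2_norm f + ell2_norm g" if F: "finite F" for F
  proof -
    have "L2_set (\<lambda>x. cmod (f x + g x)) F \<le> L2_set (\<lambda>x. cmod (f x) + cmod (g x)) F"
      by (rule L2_set_mono) (auto intro: norm_triangle_ineq)
    also have "\<dots> \<le> L2_set (\<lambda>x. cmod (f x)) F + L2_set (\<lambda>x. cmod (g x)) F"
      by (rule L2_set_triangle_ineq)
    also have "\<dots> \<le> ell2_norm f + ell2_norm g"
      by (intro add_mono L2_set_le_ell2_norm[OF assms(1) F] L2_set_le_ell2_norm[OF assms(2) F])
    finally show ?thesis .
  qed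
  show "(\<lambda>x. f x + g x) \<in> ell2 I"
    "ell2_norm (\<lambda>x. f x + g x) \<le> ell2_norm f + ell2_norm g"
    by (rule ell2_boundedI[where I=I, OF _ *];
        simp add: ell2_outside[OF assms(1)] ell2_outside[OF assms(2)])+
qed

lemma ell2_scale:
  assumes "f \<in> ell2 I"
  shows "(\<lambda>x. c * f x) \<in> ell2 I"
  using assms by (auto simp: ell2_def norm_mult power_mult_distrib intro!: summable_on_cmult_right)

lemma ell2_norm_scale: "ell2_norm (\<lambda>x. c * f x) = cmod c * ell2_norm f"
  by (simp add: ell2_norm_def norm_mult power_mult_distrib infsum_cmult_right' real_sqrt_mult)

lemma ell2_diff:
  assumes "f \<in> ell2 I" "g \<in> ell2 I"
  shows "(\<lambda>x. f x - g x) \<in> ell2 I"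
  using ell2_add[OF assms(1) ell2_scale[OF assms(2), of "-1"]] by simp

lemma ell2_norm_minus_commute: "ell2_norm (\<lambda>x. f x - g x) = ell2_norm (\<lambda>x. g x - f x)"
  by (simp add: ell2_norm_def norm_minus_commute)

text \<open>Summability is recorded next to the estimate because \<open>infsum\<close> takes the
  default value 0 on divergent families; additivity of the inner product depends on it.\<close>

lemma
  assumes "f \<in> ell2 I" "g \<in> ell2 I"
  shows ell2_inner_summable: "(\<lambda>x. f x * cnj (g x)) summable_on UNIV"
    and ell2_inner_Cauchy_Schwarz: "cmod (ell2_inner f g) \<le> ell2_norm f * ell2_norm g"
proof -
  have *: "(\<Sum>x\<in>F. cmod (f x * cnj (g x))) \<le> ell2_norm f * ell2_norm g" if F: "finite F" for F
  proof -
    have "(\<Sum>x\<in>F. cmod (f x * cnj (g x))) = (\<Sum>x\<in>F. \<bar>cmod (f x)\<bar> * \<bar>cmod (g x)\<bar>)"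
      by (simp add: norm_mult)
    also have "\<dots> \<le> L2_set (\<lambda>x. cmod (f x)) F * L2_set (\<lambda>x. cmod (g x)) F"
      by (rule L2_set_mult_ineq)
    also have "\<dots> \<le> ell2_norm f * ell2_norm g"
      by (intro mult_mono L2_set_le_ell2_norm[OF assms(1) F] L2_set_le_ell2_norm[OF assms(2) F]
          ell2_norm_nonneg L2_set_nonneg)
    finally show ?thesis .
  qed
  have s: "(\<lambda>x. cmod (f x * cnj (g x))) summable_on UNIV"
    by (rule nonneg_bdd_above_summable_on)
      (auto intro!: bdd_aboveI[where M="ell2_norm f * ell2_norm g"] *)
  show "(\<lambda>x. f x * cnj (g x)) summable_on UNIV"
    by (rule abs_summable_summable[OF s])
  have "cmod (ell2_inner f g) \<le> (\<Sum>\<^sub>\<infinity>x. cmod (f x * cnj (g x)))"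
    unfolding ell2_inner_def by (rule norm_infsum_bound[OF s])
  also have "\<dots> \<le> ell2_norm f * ell2_norm g"
    by (rule infsum_le_finite_sums[OF s]) (use * in auto)
  finally show "cmod (ell2_inner f g) \<le> ell2_norm f * ell2_norm g" .
qed

lemma ell2_inner_add_left:
  assumes "f \<in> ell2 I" "g \<in> ell2 I" "h \<in> ell2 I"
  shows "ell2_inner (\<lambda>x. f x + g x) h = ell2_inner f h + ell2_inner g h"
  unfolding ell2_inner_def
  by (simp add: distrib_right infsum_add[OF ell2_inner_summable[OF assms(1,3)]
        ell2_inner_summable[OF assms(2,3)]])

lemma ell2_inner_scale_left: "ell2_inner (\<lambda>x. c * f x) g = c * ell2_inner f g"
  by (simp add: ell2_inner_def mult.assoc infsum_cmult_right')

lemma ell2_inner_commute: "ell2_inner f g = cnj (ell2_inner g f)"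
  by (simp add: ell2_inner_def flip: infsum_cnj) (simp add: mult.commute)

lemma ell2_inner_self:
  assumes "f \<in> ell2 I"
  shows "ell2_inner f f = complex_of_real ((ell2_norm f)\<^sup>2)"
proof -
  have "((\<lambda>x. complex_of_real ((cmod (f x))\<^sup>2)) has_sum complex_of_real ((ell2_norm f)\<^sup>2)) UNIV"
    unfolding ell2_norm_power2 by (intro has_sum_of_real has_sum_infsum ell2_summable[OF assms])
  then show ?thesis unfolding ell2_inner_def complex_norm_square by (rule infsumI)
qed

lemma ell2_delta_in: "a \<in> I \<Longrightarrow> ell2_delta a \<in> ell2 I"
  and ell2_norm_delta: "ell2_norm (ell2_delta a) = 1"
proof -
  have *: "(\<lambda>x. (cmod (ell2_delta a x))\<^sup>2) = (\<lambda>x. if x = a then 1 else 0)"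
    by (auto simp: ell2_delta_def)
  have "((\<lambda>x. if x = a then 1 else 0 :: real) has_sum 1) UNIV"
    using has_sum_finite_neutralI[of "{a}" UNIV "\<lambda>x. if x = a then 1 else 0 :: real" 1] by auto
  then have sum: "((\<lambda>x. (cmod (ell2_delta a x))\<^sup>2) has_sum 1) UNIV" by (simp add: *)
  then show "ell2_norm (ell2_delta a) = 1" by (simp add: ell2_norm_def infsumI)
  show "ell2_delta a \<in> ell2 I" if "a \<in> I"
    using has_sum_imp_summable[OF sum] that by (simp add: ell2_def) (auto simp: ell2_delta_def)
qed

lemma ell2_inner_delta_left: "ell2_inner (ell2_delta a) f = cnj (f a)"
proof -
  have "((\<lambda>x. ell2_delta a x * cnj (f x)) has_sum cnj (f a)) UNIV"
    by (rule has_sum_finite_neutralI[of "{a}"]) (auto simp: ell2_delta_def)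
  then show ?thesis by (simp add: ell2_inner_def infsumI)
qed

section \<open>Bounded operators and adjoints\<close>

lemma bounded_ops_outside: "T \<in> bounded_ops I \<Longrightarrow> f \<notin> ell2 I \<Longrightarrow> T f = (\<lambda>x. 0)"
  and bounded_ops_in: "T \<in> bounded_ops I \<Longrightarrow> f \<in> ell2 I \<Longrightarrow> T f \<in> ell2 I"
  and bounded_ops_add: "T \<in> bounded_ops I \<Longrightarrow> f \<in> ell2 I \<Longrightarrow> g \<in> ell2 I \<Longrightarrow>
    T (\<lambda>x. f x + g x) = (\<lambda>x. T f x + T g x)"
  and bounded_ops_scale: "T \<in> bounded_ops I \<Longrightarrow> f \<in> ell2 I \<Longrightarrow> T (\<lambda>x. c * f x) = (\<lambda>x. c * T f x)"
  by (simp_all add: bounded_ops_def)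

text \<open>The zero normalisation off \<open>ell2 I\<close> removes the side condition on f, which
  spares it in all later uses.\<close>

lemma bounded_ops_range: "T \<in> bounded_ops I \<Longrightarrow> T f \<in> ell2 I"
  by (cases "f \<in> ell2 I") (simp_all add: bounded_ops_in bounded_ops_outside ell2_zero)

lemma bounded_ops_zero:
  assumes "T \<in> bounded_ops I"
  shows "T (\<lambda>x. 0) = (\<lambda>x. 0)"
  using bounded_ops_scale[OF assms ell2_zero, of 0] by simp

text \<open>The definition leaves the sign of the constant open; replacing C by
  \<open>max 0 C\<close> makes it safe to multiply bounds, as for compositions.\<close>

lemma bounded_ops_bound:
  assumes "T \<in> bounded_ops I"
  obtains C where "0 \<le> C" "\<And>f. f \<in> ell2 I \<Longrightarrow> ell2_norm (T f) \<le> C * ell2_norm f"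
proof -
  obtain C where C: "\<And>f. f \<in> ell2 I \<Longrightarrow> ell2_norm (T f) \<le> C * ell2_norm f"
    using assms unfolding bounded_ops_def by blast
  have "ell2_norm (T f) \<le> max 0 C * ell2_norm f" if "f \<in> ell2 I" for f
    using C[OF that] ell2_norm_nonneg[of f]
    by (meson max.cobounded2 mult_right_mono order_trans)
  then show ?thesis using that[of "max 0 C"] by auto
qed

lemma bounded_opsI:
  assumes "\<And>f. f \<notin> ell2 I \<Longrightarrow> T f = (\<lambda>x. 0)"
    and "\<And>f. f \<in> ell2 I \<Longrightarrow> T f \<in> ell2 I"
    and "\<And>f g. f \<in> ell2 I \<Longrightarrow> g \<in> ell2 I \<Longrightarrow> T (\<lambda>x. f x + g x) = (\<lambda>x. T f x + T g x)"
    and "\<And>c f. f \<in> ell2 I \<Longrightarrow> T (\<lambda>x. c * f x) = (\<lambda>x. c * T f x)"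
    and "\<And>f. f \<in> ell2 I \<Longrightarrow> ell2_norm (T f) \<le> C * ell2_norm f"
  shows "T \<in> bounded_ops I"
  unfolding bounded_ops_def using assms by blast

lemma op_zero_bounded: "op_zero \<in> bounded_ops I"
  by (rule bounded_opsI[where C=0]) (auto simp: op_zero_def ell2_zero ell2_norm_zero)

lemma op_scale_bounded:
  assumes "T \<in> bounded_ops I"
  shows "op_scale c T \<in> bounded_ops I"
proof -
  obtain C where C: "0 \<le> C" "\<And>f. f \<in> ell2 I \<Longrightarrow> ell2_norm (T f) \<le> C * ell2_norm f"
    using bounded_ops_bound[OF assms] by blast
  have "ell2_norm (\<lambda>x. c * T f x) \<le> cmod c * C * ell2_norm f" if "f \<in> ell2 I" for f
    using mult_left_mono[OF C(2)[OF that], of "cmod c"] by (simp add: ell2_norm_scale mult.assoc)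
  then show ?thesis
    unfolding op_scale_def
    by (intro bounded_opsI[where C="cmod c * C"])
      (auto simp: bounded_ops_outside[OF assms] bounded_ops_add[OF assms]
         bounded_ops_scale[OF assms] algebra_simps intro!: ell2_scale bounded_ops_in[OF assms])
qed

lemma op_add_bounded:
  assumes S: "S \<in> bounded_ops I" and T: "T \<in> bounded_ops I"
  shows "op_add S T \<in> bounded_ops I"
proof -
  obtain C where C: "0 \<le> C" "\<And>f. f \<in> ell2 I \<Longrightarrow> ell2_norm (S f) \<le> C * ell2_norm f"
    using bounded_ops_bound[OF S] by blast
  obtain D where D: "0 \<le> D" "\<And>f. f \<in> ell2 I \<Longrightarrow> ell2_norm (T f) \<le> D * ell2_norm f"
    using bounded_ops_bound[OF T] by blast
  have "ell2_norm (\<lambda>x. S f x + T f x) \<le> (C + D) * ell2_norm f" if f: "f \<in> ell2 I" for f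
    using ell2_norm_triangle[OF bounded_ops_in[OF S f] bounded_ops_in[OF T f]] C(2)[OF f] D(2)[OF f]
    by (simp add: distrib_right)
  then show ?thesis
    unfolding op_add_def
    by (intro bounded_opsI[where C="C + D"])
      (auto simp: bounded_ops_outside[OF S] bounded_ops_add[OF S] bounded_ops_scale[OF S]
         bounded_ops_outside[OF T] bounded_ops_add[OF T] bounded_ops_scale[OF T] algebra_simps
         intro!: ell2_add bounded_ops_in[OF S] bounded_ops_in[OF T])
qed

lemma op_diff_bounded:
  assumes "S \<in> bounded_ops I" "T \<in> bounded_ops I"
  shows "op_diff S T \<in> bounded_ops I"
proof -
  have "op_diff S T = op_add S (op_scale (-1) T)"
    by (simp add: op_diff_def op_add_def op_scale_def)
  then show ?thesis by (simp add: assms op_add_bounded op_scale_bounded)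
qed

lemma comp_bounded:
  assumes S: "S \<in> bounded_ops I" and T: "T \<in> bounded_ops I"
  shows "S \<circ> T \<in> bounded_ops I"
proof -
  obtain C where C: "0 \<le> C" "\<And>f. f \<in> ell2 I \<Longrightarrow> ell2_norm (S f) \<le> C * ell2_norm f"
    using bounded_ops_bound[OF S] by blast
  obtain D where D: "0 \<le> D" "\<And>f. f \<in> ell2 I \<Longrightarrow> ell2_norm (T f) \<le> D * ell2_norm f"
    using bounded_ops_bound[OF T] by blast
  have "ell2_norm (S (T f)) \<le> (C * D) * ell2_norm f" if f: "f \<in> ell2 I" for f
    using C(2)[OF bounded_ops_in[OF T f]] mult_left_mono[OF D(2)[OF f] C(1)] by simp
  then show ?thesis
    by (intro bounded_opsI[where C="C * D"])
      (auto simp: bounded_ops_outside[OF T] bounded_ops_zero[OF S] bounded_ops_in[OF S]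
         bounded_ops_in[OF T] bounded_ops_add[OF T] bounded_ops_add[OF S]
         bounded_ops_scale[OF S] bounded_ops_scale[OF T])
qed

section \<open>The operator norm as a real supremum\<close>

lemma op_norm_upper:
  assumes "T \<in> bounded_ops I" "f \<in> ell2 I" "ell2_norm f \<le> 1"
  shows "ell2_norm (T f) \<le> op_norm I T"
proof -
  obtain C where C: "0 \<le> C" "\<And>f. f \<in> ell2 I \<Longrightarrow> ell2_norm (T f) \<le> C * ell2_norm f"
    using bounded_ops_bound[OF assms(1)] by blast
  \<comment> \<open>A real supremum bounds its members only if the set is bounded above; on the
    closed unit ball C is such a bound.\<close>
  have "bdd_above ((\<lambda>f. ell2_norm (T f)) ` {f \<in> ell2 I. ell2_norm f \<le> 1})"
  proof (rule bdd_aboveI2)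
    fix f assume "f \<in> {f \<in> ell2 I. ell2_norm f \<le> 1}"
    then show "ell2_norm (T f) \<le> C"
      using C(2)[of f] mult_left_mono[OF _ C(1), of "ell2_norm f" 1] by simp
  qed
  then show ?thesis
    unfolding op_norm_def using assms by (intro cSUP_upper) auto
qed

lemma op_norm_least:
  assumes "\<And>f. f \<in> ell2 I \<Longrightarrow> ell2_norm f \<le> 1 \<Longrightarrow> ell2_norm (T f) \<le> B"
  shows "op_norm I T \<le> B"
proof -
  have "(\<lambda>x. 0) \<in> {f \<in> ell2 I. ell2_norm f \<le> 1}"
    by (simp add: ell2_zero ell2_norm_zero)
  then show ?thesis
    unfolding op_norm_def using assms by (intro cSUP_least) auto
qed

lemma op_norm_diff_commute: "op_norm I (op_diff S T) = op_norm I (op_diff T S)"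
  unfolding op_norm_def op_diff_def by (intro SUP_cong refl ell2_norm_minus_commute)

section \<open>Truncations and approximation by finitely supported functions\<close>

definition ell2_restrict :: "'a set \<Rightarrow> ('a \<Rightarrow> complex) \<Rightarrow> ('a \<Rightarrow> complex)" where
  "ell2_restrict F f = (\<lambda>x. if x \<in> F then f x else 0)"

lemma
  assumes "f \<in> ell2 I"
  shows ell2_restrict_in: "ell2_restrict F f \<in> ell2 I"
    and ell2_norm_restrict_le: "ell2_norm (ell2_restrict F f) \<le> ell2_norm f"
proof -
  have *: "L2_set (\<lambda>x. cmod (ell2_restrict F f x)) A \<le> ell2_norm f" if "finite A" for A
  proof -
    have "L2_set (\<lambda>x. cmod (ell2_restrict F f x)) A \<le> L2_set (\<lambda>x. cmod (f x)) A"
      by (rule L2_set_mono) (auto simp: ell2_restrict_def)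
    also have "\<dots> \<le> ell2_norm f" by (rule L2_set_le_ell2_norm[OF assms that])
    finally show ?thesis .
  qed
  show "ell2_restrict F f \<in> ell2 I" "ell2_norm (ell2_restrict F f) \<le> ell2_norm f"
    by (rule ell2_boundedI[where I=I, OF _ *]; simp add: ell2_restrict_def ell2_outside[OF assms])+
qed

text \<open>Holds for any function f: the construction of the adjoint truncates a function not yet
  known to be square-summable.\<close>

lemma ell2_norm_restrict_finite:
  assumes "finite F"
  shows "(ell2_norm (ell2_restrict F f))\<^sup>2 = (\<Sum>x\<in>F. (cmod (f x))\<^sup>2)"
proof -
  have "((\<lambda>x. (cmod (ell2_restrict F f x))\<^sup>2) has_sum (\<Sum>x\<in>F. (cmod (f x))\<^sup>2)) UNIV"
    by (rule has_sum_finite_neutralI[OF assms]) (auto simp: ell2_restrict_def)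
  then show ?thesis by (simp add: ell2_norm_power2 infsumI)
qed

lemma ell2_restrict_finite_tendsto:
  assumes "f \<in> ell2 I"
  shows "((\<lambda>F. ell2_norm (\<lambda>x. f x - ell2_restrict F f x)) \<longlongrightarrow> 0) (finite_subsets_at_top UNIV)"
proof -
  have s: "(\<lambda>x. (cmod (f x))\<^sup>2) summable_on UNIV" by (rule ell2_summable[OF assms])
  have "((\<lambda>F. sqrt ((ell2_norm f)\<^sup>2 - (\<Sum>x\<in>F. (cmod (f x))\<^sup>2))) \<longlongrightarrow> sqrt ((ell2_norm f)\<^sup>2 - (ell2_norm f)\<^sup>2))
      (finite_subsets_at_top UNIV)"
    using infsum_tendsto[OF s] by (intro tendsto_intros) (simp add: ell2_norm_power2)
  moreover have "\<forall>\<^sub>F F in finite_subsets_at_top UNIV.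
      sqrt ((ell2_norm f)\<^sup>2 - (\<Sum>x\<in>F. (cmod (f x))\<^sup>2)) = ell2_norm (\<lambda>x. f x - ell2_restrict F f x)"
  proof (rule eventually_finite_subsets_at_top_weakI)
    fix F :: "'a set" assume F: "finite F"
    \<comment> \<open>Pythagoras, pointwise: the truncation equals f or 0 at each point, so the
      difference of the squares is the square of the difference.\<close>
    have "((\<lambda>x. (cmod (f x))\<^sup>2 + - (cmod (ell2_restrict F f x))\<^sup>2) has_sum
        ((ell2_norm f)\<^sup>2 + - (\<Sum>x\<in>F. (cmod (f x))\<^sup>2))) UNIV"
      unfolding ell2_norm_power2
      by (intro has_sum_add has_sum_infsum[OF s] has_sum_finite_neutralI[OF F])
        (auto simp: ell2_restrict_def sum_negf)
    moreover have "(\<lambda>x. (cmod (f x))\<^sup>2 + - (cmod (ell2_restrict F f x))\<^sup>2) =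
        (\<lambda>x. (cmod (f x - ell2_restrict F f x))\<^sup>2)"
      by (auto simp: ell2_restrict_def)
    ultimately show "sqrt ((ell2_norm f)\<^sup>2 - (\<Sum>x\<in>F. (cmod (f x))\<^sup>2)) =
        ell2_norm (\<lambda>x. f x - ell2_restrict F f x)"
      by (simp add: ell2_norm_def infsumI)
  qed
  ultimately show ?thesis by (simp add: tendsto_cong)
qed

lemma bounded_ops_restrict_finite:
  assumes T: "T \<in> bounded_ops I" and f: "f \<in> ell2 I" and g: "g \<in> ell2 I" and "finite F"
  shows "ell2_inner (T (ell2_restrict F f)) g = (\<Sum>x\<in>F. f x * ell2_inner (T (ell2_delta x)) g)"
  using \<open>finite F\<close>
proof induction
  case empty
  then show ?case
    by (simp add: ell2_restrict_def bounded_ops_zero[OF T] ell2_inner_def)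
next
  case (insert a F)
  show ?case
  proof (cases "a \<in> I")
    case True
    have d: "ell2_delta a \<in> ell2 I" by (rule ell2_delta_in[OF True])
    have "ell2_restrict (insert a F) f = (\<lambda>x. f a * ell2_delta a x + ell2_restrict F f x)"
      using insert.hyps by (auto simp: ell2_restrict_def ell2_delta_def)
    then have "T (ell2_restrict (insert a F) f) =
        (\<lambda>x. f a * T (ell2_delta a) x + T (ell2_restrict F f) x)"
      by (simp add: bounded_ops_add[OF T ell2_scale[OF d] ell2_restrict_in[OF f]]
          bounded_ops_scale[OF T d])
    then show ?thesis
      using insert by (simp add: ell2_inner_add_left[OF ell2_scale[OF bounded_ops_range[OF T]]
            bounded_ops_range[OF T] g] ell2_inner_scale_left)
  next
    case False
    then have "f a = 0" by (rule ell2_outside[OF f])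
    then have "ell2_restrict (insert a F) f = ell2_restrict F f"
      by (auto simp: ell2_restrict_def)
    then show ?thesis using insert \<open>f a = 0\<close> by simp
  qed
qed

text \<open>By boundedness of T and Cauchy-Schwarz, the error after truncating to F is at most C
  times the norm of the remainder of f times the norm of g. Thus T is determined by its values on
  the basis vectors, which extends the adjoint identity from these to all f.\<close>

lemma bounded_ops_inner_has_sum:
  assumes T: "T \<in> bounded_ops I" and f: "f \<in> ell2 I" and g: "g \<in> ell2 I"
  shows "((\<lambda>x. f x * ell2_inner (T (ell2_delta x)) g) has_sum ell2_inner (T f) g) UNIV"
proof -
  obtain C where C: "0 \<le> C" "\<And>f. f \<in> ell2 I \<Longrightarrow> ell2_norm (T f) \<le> C * ell2_norm f"
    using bounded_ops_bound[OF T] by blast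
  let ?r = "\<lambda>F. \<lambda>x. f x - ell2_restrict F f x"
  have "((\<lambda>F. C * ell2_norm (?r F) * ell2_norm g) \<longlongrightarrow> C * 0 * ell2_norm g) (finite_subsets_at_top UNIV)"
    by (intro tendsto_intros ell2_restrict_finite_tendsto[OF f])
  then have lim: "((\<lambda>F. C * ell2_norm (?r F) * ell2_norm g) \<longlongrightarrow> 0) (finite_subsets_at_top UNIV)"
    by simp
  have "((\<lambda>F. (\<Sum>x\<in>F. f x * ell2_inner (T (ell2_delta x)) g) - ell2_inner (T f) g) \<longlongrightarrow> 0)
      (finite_subsets_at_top UNIV)"
  proof (rule Lim_null_comparison[OF _ lim], rule eventually_finite_subsets_at_top_weakI)
    fix F :: "'a set" assume F: "finite F"
    have rF: "?r F \<in> ell2 I" by (intro ell2_diff ell2_restrict_in f)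
    have "ell2_inner (T f) g = ell2_inner (\<lambda>x. T (ell2_restrict F f) x + T (?r F) x) g"
      using bounded_ops_add[OF T ell2_restrict_in[OF f] rF, of F] by simp
    also have "\<dots> = (\<Sum>x\<in>F. f x * ell2_inner (T (ell2_delta x)) g) + ell2_inner (T (?r F)) g"
      by (simp add: ell2_inner_add_left[OF bounded_ops_range[OF T] bounded_ops_range[OF T] g]
          bounded_ops_restrict_finite[OF T f g F])
    finally have "cmod ((\<Sum>x\<in>F. f x * ell2_inner (T (ell2_delta x)) g) - ell2_inner (T f) g)
        = cmod (ell2_inner (T (?r F)) g)"
      by simp
    also have "\<dots> \<le> ell2_norm (T (?r F)) * ell2_norm g"
      by (rule ell2_inner_Cauchy_Schwarz[OF bounded_ops_range[OF T] g])
    also have "\<dots> \<le> C * ell2_norm (?r F) * ell2_norm g"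
      by (intro mult_right_mono C(2) rF ell2_norm_nonneg)
    finally show "cmod ((\<Sum>x\<in>F. f x * ell2_inner (T (ell2_delta x)) g) - ell2_inner (T f) g)
        \<le> C * ell2_norm (?r F) * ell2_norm g" .
  qed
  then show ?thesis
    unfolding has_sum_def by (simp add: LIM_zero_iff)
qed

section \<open>Existence and uniqueness of adjoints\<close>

lemma adjoint_exists:
  assumes T: "T \<in> bounded_ops I"
  shows "\<exists>S \<in> bounded_ops I. \<forall>f\<in>ell2 I. \<forall>g\<in>ell2 I. ell2_inner (T f) g = ell2_inner f (S g)"
proof -
  obtain C where C: "0 \<le> C" "\<And>f. f \<in> ell2 I \<Longrightarrow> ell2_norm (T f) \<le> C * ell2_norm f"
    using bounded_ops_bound[OF T] by blast
  \<comment> \<open>Testing the adjoint identity on \<open>ell2_delta x\<close> leaves no choice: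
    the inner product of T \<open>ell2_delta x\<close> with g must be the conjugate of
    \<open>S g x\<close>.\<close>
  define S where "S = (\<lambda>g x. if g \<in> ell2 I \<and> x \<in> I then ell2_inner g (T (ell2_delta x)) else 0)"
  \<comment> \<open>The test vector is \<open>S g\<close> itself, cut down to F. Pairing its image
    under T with g gives exactly \<open>?N\<^sup>2\<close>, and boundedness of T gives at most
    \<open>C * ?N * ell2_norm g\<close>; cancelling one factor \<open>?N\<close> bounds
    \<open>S g\<close> on F uniformly in F.\<close>
  have bound: "L2_set (\<lambda>x. cmod (S g x)) F \<le> C * ell2_norm g" if g: "g \<in> ell2 I" and F: "finite F" for g F
  proof -
    let ?f = "ell2_restrict F (S g)"
    let ?N = "L2_set (\<lambda>x. cmod (S g x)) F"
    have N0: "0 \<le> ?N" by (rule L2_set_nonneg)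
    have N: "?N\<^sup>2 = (\<Sum>x\<in>F. (cmod (S g x))\<^sup>2)"
      by (simp add: L2_set_def sum_nonneg)
    have f: "?f \<in> ell2 I"
    proof -
      \<comment> \<open>Membership comes from finiteness of the support, since
        \<open>ell2_restrict_in\<close> would presuppose that \<open>S g\<close> is
        square-summable.\<close>
      have "(\<lambda>x. (cmod (?f x))\<^sup>2) summable_on UNIV"
        by (rule summable_on_cong_neutral[THEN iffD1, OF _ _ _ summable_on_finite[OF F,
                of "\<lambda>x. (cmod (S g x))\<^sup>2"]]) (auto simp: ell2_restrict_def)
      then show ?thesis by (auto simp: ell2_def ell2_restrict_def S_def)
    qed
    have nf: "ell2_norm ?f = ?N"
      by (rule power2_eq_imp_eq) (simp_all add: ell2_norm_restrict_finite[OF F] N N0 ell2_norm_nonneg)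
    have idem: "ell2_restrict F ?f = ?f" by (auto simp: ell2_restrict_def)
    have "ell2_inner (T ?f) g = (\<Sum>x\<in>F. ?f x * ell2_inner (T (ell2_delta x)) g)"
      using bounded_ops_restrict_finite[OF T f g F] by (simp add: idem)
    also have "\<dots> = (\<Sum>x\<in>F. complex_of_real ((cmod (S g x))\<^sup>2))"
    proof (rule sum.cong[OF refl])
      fix x assume "x \<in> F"
      show "?f x * ell2_inner (T (ell2_delta x)) g = complex_of_real ((cmod (S g x))\<^sup>2)"
      proof (cases "x \<in> I")
        case True
        then have "ell2_inner (T (ell2_delta x)) g = cnj (S g x)"
          by (simp add: S_def g ell2_inner_commute[of g])
        then show ?thesis
          using \<open>x \<in> F\<close> unfolding complex_norm_square by (simp add: ell2_restrict_def)
      qed (simp add: S_def ell2_restrict_def)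
    qed
    finally have "ell2_inner (T ?f) g = complex_of_real (?N\<^sup>2)"
      by (simp add: N)
    then have "?N\<^sup>2 = cmod (ell2_inner (T ?f) g)"
      by (simp add: norm_power)
    also have "\<dots> \<le> ell2_norm (T ?f) * ell2_norm g"
      by (rule ell2_inner_Cauchy_Schwarz[OF bounded_ops_range[OF T] g])
    also have "\<dots> \<le> C * ?N * ell2_norm g"
      using C(2)[OF f] by (intro mult_right_mono ell2_norm_nonneg) (simp add: nf)
    finally have "?N * ?N \<le> ?N * (C * ell2_norm g)"
      by (simp add: power2_eq_square mult_ac)
    then show ?thesis
      using N0 C(1) ell2_norm_nonneg[of g]
      by (cases "?N = 0") (simp_all add: mult_le_cancel_left)
  qed
  have "S \<in> bounded_ops I"
  proof (rule bounded_opsI)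
    fix f assume f: "f \<in> ell2 I"
    have "\<And>x. x \<notin> I \<Longrightarrow> S f x = 0" by (simp add: S_def)
    from ell2_boundedI[OF this bound[OF f]]
    show "S f \<in> ell2 I" "ell2_norm (S f) \<le> C * ell2_norm f" by auto
    show "S (\<lambda>x. c * f x) = (\<lambda>x. c * S f x)" for c
      using ell2_scale[OF f, of c] f by (auto simp: S_def ell2_inner_scale_left)
    show "S (\<lambda>x. f x + g x) = (\<lambda>x. S f x + S g x)" if g: "g \<in> ell2 I" for g
      using ell2_add[OF f g] f g
      by (auto simp: S_def ell2_inner_add_left[OF f g bounded_ops_range[OF T]])
  qed (auto simp: S_def)
  moreover have "ell2_inner (T f) g = ell2_inner f (S g)" if f: "f \<in> ell2 I" and g: "g \<in> ell2 I" for f g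
  proof -
    have "(\<lambda>x. f x * ell2_inner (T (ell2_delta x)) g) = (\<lambda>x. f x * cnj (S g x))"
      using ell2_outside[OF f] by (auto simp: S_def g ell2_inner_commute[of g])
    then show ?thesis
      using bounded_ops_inner_has_sum[OF T f g] by (simp add: ell2_inner_def[of f] infsumI)
  qed
  ultimately show ?thesis by blast
qed

lemma ell2_eqI_inner:
  assumes "u \<in> ell2 I" "v \<in> ell2 I" "\<And>f. f \<in> ell2 I \<Longrightarrow> ell2_inner f u = ell2_inner f v"
  shows "u = v"
proof
  fix x show "u x = v x"
    using assms(3)[OF ell2_delta_in, of x] assms(1,2)
    by (cases "x \<in> I") (simp_all add: ell2_inner_delta_left ell2_outside)
qed

lemma
  assumes T: "T \<in> bounded_ops I"
  shows op_adj_bounded: "op_adj I T \<in> bounded_ops I"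
    and op_adj_inner: "f \<in> ell2 I \<Longrightarrow> g \<in> ell2 I \<Longrightarrow> ell2_inner (T f) g = ell2_inner f (op_adj I T g)"
proof -
  let ?P = "\<lambda>S. S \<in> bounded_ops I \<and> (\<forall>f\<in>ell2 I. \<forall>g\<in>ell2 I. ell2_inner (T f) g = ell2_inner f (S g))"
  have "\<exists>!S. ?P S"
  proof (rule ex_ex1I)
    show "\<exists>S. ?P S" using adjoint_exists[OF T] by blast
    fix S S' assume S: "?P S" and S': "?P S'"
    show "S = S'"
    proof
      fix g show "S g = S' g"
      proof (cases "g \<in> ell2 I")
        case True
        show ?thesis
          by (rule ell2_eqI_inner[of _ I]) (use S S' True in \<open>auto intro: bounded_ops_in\<close>)
      next
        case False
        \<comment> \<open>Off the Hilbert space the inner product identity says nothing; the zero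
          normalisation forces agreement there, so the definite description is well defined.\<close>
        have "S g = (\<lambda>x. 0)" "S' g = (\<lambda>x. 0)"
          using S S' by (blast intro: bounded_ops_outside[OF _ False])+
        then show ?thesis by simp
      qed
    qed
  qed
  then have "?P (op_adj I T)" unfolding op_adj_def by (rule theI')
  then show "op_adj I T \<in> bounded_ops I"
    "f \<in> ell2 I \<Longrightarrow> g \<in> ell2 I \<Longrightarrow> ell2_inner (T f) g = ell2_inner f (op_adj I T g)"
    by auto
qed

section \<open>The projection onto the functions supported on a subset\<close>

definition ell2_proj :: "'a set \<Rightarrow> 'a set \<Rightarrow> 'a operator" where
  "ell2_proj I K = (\<lambda>f. if f \<in> ell2 I then ell2_restrict K f else (\<lambda>x. 0))"

lemma ell2_proj_bounded: "ell2_proj I K \<in> bounded_ops I"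
proof (rule bounded_opsI[where C=1])
  fix f assume f: "f \<in> ell2 I"
  show "ell2_proj I K (\<lambda>x. f x + g x) = (\<lambda>x. ell2_proj I K f x + ell2_proj I K g x)"
    if g: "g \<in> ell2 I" for g
    using f g ell2_add[OF f g] by (auto simp: ell2_proj_def ell2_restrict_def)
  show "ell2_proj I K (\<lambda>x. c * f x) = (\<lambda>x. c * ell2_proj I K f x)" for c
    using f ell2_scale[OF f, of c] by (auto simp: ell2_proj_def ell2_restrict_def)
qed (simp_all add: ell2_proj_def ell2_restrict_in ell2_norm_restrict_le)

lemma ell2_proj_self_adjoint:
  assumes "f \<in> ell2 I" "g \<in> ell2 I"
  shows "ell2_inner (ell2_proj I K f) g = ell2_inner f (ell2_proj I K g)"
  unfolding ell2_inner_def
  by (rule infsum_cong) (simp add: assms ell2_proj_def ell2_restrict_def)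

text \<open>Makes this commutant a competitor in the intersection defining the generated
  star-algebra. The delicate closure is under adjoints: since the projection is self-adjoint, moving
  it and T across the inner product carries the commutation relation from T to its adjoint.\<close>

lemma commutant_proj_star_subalgebra: "star_subalgebra I (commutant I {ell2_proj I K})"
proof -
  let ?p = "ell2_proj I K"
  note p = ell2_proj_bounded[of I K]
  \<comment> \<open>Off the Hilbert space both composites give zero, so commutation need only be
    tested on vectors of \<open>ell2 I\<close>.\<close>
  have mem: "T \<in> commutant I {?p} \<longleftrightarrow> T \<in> bounded_ops I \<and> (\<forall>f\<in>ell2 I. T (?p f) = ?p (T f))" for T
  proof -
    have "T (?p f) = ?p (T f)" if "T \<in> bounded_ops I" "f \<notin> ell2 I" for f
      using that by (simp add: bounded_ops_outside[OF p] bounded_ops_outside bounded_ops_zero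
          bounded_ops_zero[OF p])
    then show ?thesis
      unfolding commutant_def fun_eq_iff[of "_ \<circ> _"] by auto
  qed
  have "op_adj I T \<in> commutant I {?p}" if "T \<in> commutant I {?p}" for T
  proof -
    have T: "T \<in> bounded_ops I" and c: "\<And>f. f \<in> ell2 I \<Longrightarrow> T (?p f) = ?p (T f)"
      using that by (auto simp: mem)
    note A = op_adj_bounded[OF T] and in_p = bounded_ops_range[OF p]
      and in_T = bounded_ops_range[OF T]
    have "op_adj I T (?p g) = ?p (op_adj I T g)" if g: "g \<in> ell2 I" for g
    proof (rule ell2_eqI_inner[of _ I])
      fix f assume f: "f \<in> ell2 I"
      have "ell2_inner f (op_adj I T (?p g)) = ell2_inner (T f) (?p g)"
        by (simp add: op_adj_inner[OF T f in_p])
      also have "\<dots> = ell2_inner (T (?p f)) g"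
        by (simp add: ell2_proj_self_adjoint[OF in_T g] c[OF f])
      also have "\<dots> = ell2_inner f (?p (op_adj I T g))"
        by (simp add: op_adj_inner[OF T in_p g] ell2_proj_self_adjoint[OF f bounded_ops_range[OF A]])
      finally show "ell2_inner f (op_adj I T (?p g)) = ell2_inner f (?p (op_adj I T g))" .
    qed (auto intro: bounded_ops_range[OF A] bounded_ops_range[OF p])
    then show ?thesis by (simp add: mem A)
  qed
  moreover have "op_zero \<in> commutant I {?p}"
    by (simp add: mem op_zero_bounded) (simp add: op_zero_def bounded_ops_zero[OF p])
  moreover have "op_add S T \<in> commutant I {?p}"
    if "S \<in> commutant I {?p}" "T \<in> commutant I {?p}" for S T
    using that by (auto simp: mem op_add_bounded)
      (simp add: op_add_def bounded_ops_add[OF p bounded_ops_range bounded_ops_range])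
  moreover have "op_scale c T \<in> commutant I {?p}" if "T \<in> commutant I {?p}" for c T
    using that by (auto simp: mem op_scale_bounded)
      (simp add: op_scale_def bounded_ops_scale[OF p bounded_ops_range])
  moreover have "S \<circ> T \<in> commutant I {?p}"
    if "S \<in> commutant I {?p}" "T \<in> commutant I {?p}" for S T
    using that by (auto simp: mem comp_bounded bounded_ops_range)
  ultimately show ?thesis
    unfolding star_subalgebra_def by (auto simp: mem)
qed

text \<open>The projection fixes \<open>ell2_delta a\<close>, so by commutation it also fixes the
  image of that vector under T.\<close>

lemma commutant_proj_delta_support:
  assumes T: "T \<in> commutant I {ell2_proj I K}" and "a \<in> K" "a \<in> I" "x \<notin> K"
  shows "T (ell2_delta a) x = 0"
proof -
  have d: "ell2_delta a \<in> ell2 I" by (simp add: ell2_delta_in assms)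
  have Tb: "T \<in> bounded_ops I" using T by (simp add: commutant_def)
  have "ell2_proj I K (ell2_delta a) = ell2_delta a"
    using \<open>a \<in> K\<close> d by (auto simp: ell2_proj_def ell2_restrict_def ell2_delta_def)
  then have "T (ell2_delta a) = ell2_proj I K (T (ell2_delta a))"
    using T unfolding commutant_def by (auto dest: fun_cong[where x="ell2_delta a"])
  then have "T (ell2_delta a) x = ell2_proj I K (T (ell2_delta a)) x" by simp
  also have "\<dots> = 0"
    using \<open>x \<notin> K\<close> bounded_ops_range[OF Tb] by (simp add: ell2_proj_def ell2_restrict_def)
  finally show ?thesis .
qed

section \<open>The left regular representation\<close>

text \<open>Left multiplication by g inverts that by \<open>inv g\<close>, so the series of squares
  is only reindexed; passing between \<open>carrier G\<close> and the whole type is free because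
  both functions vanish off the carrier.\<close>

lemma (in group) left_regular_ell2:
  assumes g: "g \<in> carrier G" and f: "f \<in> ell2 (carrier G)"
  shows "left_regular G g f \<in> ell2 (carrier G)"
    and "ell2_norm (left_regular G g f) = ell2_norm f"
proof -
  let ?I = "carrier G"
  let ?L = "left_regular G g f"
  have bij: "bij_betw (\<lambda>x. inv g \<otimes> x) ?I ?I"
    by (rule bij_betwI[where g="\<lambda>x. g \<otimes> x"]) (auto simp: g m_assoc[symmetric])
  have L: "(cmod (?L x))\<^sup>2 = (cmod (f (inv g \<otimes> x)))\<^sup>2" if "x \<in> ?I" for x
    using that f by (simp add: left_regular_def)
  have off: "?L x = 0" if "x \<notin> ?I" for x
    using that by (simp add: left_regular_def)
  have "(\<lambda>x. (cmod (f x))\<^sup>2) summable_on ?I"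
    using ell2_summable[OF f] by (rule summable_on_subset_banach) simp
  then have "(\<lambda>x. (cmod (f (inv g \<otimes> x)))\<^sup>2) summable_on ?I"
    by (simp add: summable_on_reindex_bij_betw[OF bij, of "\<lambda>x. (cmod (f x))\<^sup>2"])
  then have "(\<lambda>x. (cmod (?L x))\<^sup>2) summable_on ?I"
    using L by (simp cong: summable_on_cong)
  then have "(\<lambda>x. (cmod (?L x))\<^sup>2) summable_on UNIV"
    using off by (subst summable_on_cong_neutral[where T="?I" and g="\<lambda>x. (cmod (?L x))\<^sup>2"]) auto
  then show "?L \<in> ell2 ?I" using off by (simp add: ell2_def)
  have "(\<Sum>\<^sub>\<infinity>x. (cmod (?L x))\<^sup>2) = (\<Sum>\<^sub>\<infinity>x\<in>?I. (cmod (?L x))\<^sup>2)"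
    by (rule infsum_cong_neutral) (auto simp: off)
  also have "\<dots> = (\<Sum>\<^sub>\<infinity>x\<in>?I. (cmod (f (inv g \<otimes> x)))\<^sup>2)"
    by (rule infsum_cong) (rule L)
  also have "\<dots> = (\<Sum>\<^sub>\<infinity>x\<in>?I. (cmod (f x))\<^sup>2)"
    by (rule infsum_reindex_bij_betw[OF bij])
  also have "\<dots> = (\<Sum>\<^sub>\<infinity>x. (cmod (f x))\<^sup>2)"
    by (rule infsum_cong_neutral) (auto simp: ell2_outside[OF f])
  finally show "ell2_norm ?L = ell2_norm f" by (simp add: ell2_norm_def)
qed

lemma (in group) left_regular_bounded:
  assumes g: "g \<in> carrier G"
  shows "left_regular G g \<in> bounded_ops (carrier G)"
proof (rule bounded_opsI[where C=1])
  fix f assume f: "f \<in> ell2 (carrier G)"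
  show "left_regular G g (\<lambda>x. f x + h x) = (\<lambda>x. left_regular G g f x + left_regular G g h x)"
    if h: "h \<in> ell2 (carrier G)" for h
    using f h ell2_add[OF f h] by (auto simp: left_regular_def)
  show "left_regular G g (\<lambda>x. c * f x) = (\<lambda>x. c * left_regular G g f x)" for c
    using f ell2_scale[OF f, of c] by (auto simp: left_regular_def)
qed (auto simp: left_regular_ell2[OF g], auto simp: left_regular_def)

lemma (in group) left_regular_delta_one:
  assumes g: "g \<in> carrier G"
  shows "left_regular G g (ell2_delta \<one>) = ell2_delta g"
proof
  fix x
  have "inv g \<otimes> x = \<one> \<longleftrightarrow> x = g" if "x \<in> carrier G"
    using that g by (metis inv_closed inv_inv inv_equality l_inv)
  then show "left_regular G g (ell2_delta \<one>) x = ell2_delta g x"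
    using g by (auto simp: left_regular_def ell2_delta_in) (auto simp: ell2_delta_def)
qed

lemma (in group) left_regular_op_norm:
  assumes "g \<in> carrier G"
  shows "op_norm (carrier G) (left_regular G g) \<le> 1"
  by (rule op_norm_least) (simp add: left_regular_ell2[OF assms])

text \<open>Left multiplication by \<open>inv k\<close> preserves both K and its complement in the
  carrier, so translation and cutting off to K may be done in either order.\<close>

lemma (in group) left_regular_proj_commute:
  assumes K: "subgroup K G" and k: "k \<in> K"
  shows "left_regular G k \<circ> ell2_proj (carrier G) K = ell2_proj (carrier G) K \<circ> left_regular G k"
proof
  fix f
  let ?p = "ell2_proj (carrier G) K"
  have kG: "k \<in> carrier G" using subgroup.mem_carrier[OF K k] .
  have iff: "inv k \<otimes> x \<in> K \<longleftrightarrow> x \<in> K" if x: "x \<in> carrier G" for x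
  proof
    assume "inv k \<otimes> x \<in> K"
    then have "k \<otimes> (inv k \<otimes> x) \<in> K" using K k by (simp add: subgroup.m_closed)
    then show "x \<in> K" using x kG by (simp add: m_assoc[symmetric])
  qed (use K k in \<open>simp add: subgroup.m_closed subgroup.m_inv_closed\<close>)
  show "(left_regular G k \<circ> ?p) f = (?p \<circ> left_regular G k) f"
  proof (cases "f \<in> ell2 (carrier G)")
    case True
    then show ?thesis
      using left_regular_ell2(1)[OF kG True] ell2_restrict_in[OF True, of K] iff
      by (auto simp: ell2_proj_def left_regular_def) (auto simp: ell2_restrict_def)
  next
    case False
    then show ?thesis
      by (simp add: bounded_ops_outside[OF left_regular_bounded[OF kG]]
          bounded_ops_outside[OF ell2_proj_bounded] bounded_ops_zero[OF ell2_proj_bounded]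
          bounded_ops_zero[OF left_regular_bounded[OF kG]])
  qed
qed

section \<open>Distances between algebras\<close>

lemma (in group) tau_norm_eq:
  assumes T: "T \<in> bounded_ops (carrier G)"
  shows "tau_norm G T = ell2_norm (T (ell2_delta \<one>))"
proof -
  let ?v = "T (ell2_delta \<one>)"
  have v: "?v \<in> ell2 (carrier G)" by (rule bounded_ops_range[OF T])
  \<comment> \<open>The adjoint identity has the adjoint in the second slot, whence the conjugate;
    it disappears because the squared norm is real.\<close>
  have "group_trace G (op_adj (carrier G) T \<circ> T) = cnj (ell2_inner ?v ?v)"
    unfolding group_trace_def comp_apply
    by (subst ell2_inner_commute) (simp add: op_adj_inner[OF T ell2_delta_in v])
  then show ?thesis
    by (simp add: tau_norm_def ell2_inner_self[OF v] ell2_norm_nonneg flip: of_real_power)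
qed

lemma (in group) tau_norm_le_op_norm:
  assumes T: "T \<in> bounded_ops (carrier G)"
  shows "tau_norm G T \<le> op_norm (carrier G) T"
  using op_norm_upper[OF T ell2_delta_in, of \<one>] by (simp add: tau_norm_eq[OF T] ell2_norm_delta)

text \<open>It suffices to read off the coordinate at g, which is 1 for the translate and 0 for y.
  No norm bound on y enters, as d_C requires.\<close>

lemma (in group) tau_norm_left_regular_diff_ge:
  assumes K: "subgroup K G" and g: "g \<in> carrier G" "g \<notin> K"
    and y: "y \<in> commutant (carrier G) {ell2_proj (carrier G) K}"
  shows "1 \<le> tau_norm G (op_diff (left_regular G g) y)"
proof -
  have yb: "y \<in> bounded_ops (carrier G)" using y by (simp add: commutant_def)
  let ?d = "op_diff (left_regular G g) y"
  have d: "?d \<in> bounded_ops (carrier G)"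
    by (intro op_diff_bounded left_regular_bounded g yb)
  have "y (ell2_delta \<one>) g = 0"
    by (rule commutant_proj_delta_support[OF y]) (auto simp: subgroup.one_closed[OF K] g)
  then have "?d (ell2_delta \<one>) g = 1"
    by (simp add: op_diff_def left_regular_delta_one[OF g(1)]) (simp add: ell2_delta_def)
  then show ?thesis
    using cmod_le_ell2_norm[OF bounded_ops_range[OF d], of "ell2_delta \<one>" g] tau_norm_eq[OF d]
    by simp
qed

lemma (in group) tau_norm_diff_commute:
  assumes "S \<in> bounded_ops (carrier G)" "T \<in> bounded_ops (carrier G)"
  shows "tau_norm G (op_diff S T) = tau_norm G (op_diff T S)"
  unfolding tau_norm_eq[OF op_diff_bounded[OF assms]] tau_norm_eq[OF op_diff_bounded[OF assms(2,1)]]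
  unfolding op_diff_def by (rule ell2_norm_minus_commute)

section \<open>Suprema of infima of a real function\<close>

lemma
  fixes d :: "'a \<Rightarrow> 'b \<Rightarrow> real"
  assumes "\<And>x y. x \<in> A \<Longrightarrow> y \<in> B \<Longrightarrow> 0 \<le> d x y"
    and "a \<in> A" "b \<in> B" "\<And>x. x \<in> A \<Longrightarrow> d x b \<le> 1"
  shows SUP_INF_le_one: "(SUP x\<in>A. INF y\<in>B. d x y) \<le> 1"
    and SUP_INF_ge_one: "x \<in> A \<Longrightarrow> (\<And>y. y \<in> B \<Longrightarrow> 1 \<le> d x y) \<Longrightarrow> 1 \<le> (SUP x\<in>A. INF y\<in>B. d x y)"
proof -
  \<comment> \<open>The single point b, later the zero operator, bounds every infimum by 1. This
    also gives the boundedness above that the outer real supremum needs.\<close>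
  have le: "(INF y\<in>B. d x y) \<le> 1" if "x \<in> A" for x
    by (rule cINF_lower2[OF _ \<open>b \<in> B\<close>]) (use assms that in \<open>auto intro!: bdd_belowI2[where m=0]\<close>)
  then show "(SUP x\<in>A. INF y\<in>B. d x y) \<le> 1"
    using \<open>a \<in> A\<close> by (intro cSUP_least) auto
  assume x: "x \<in> A" and ge: "\<And>y. y \<in> B \<Longrightarrow> 1 \<le> d x y"
  show "1 \<le> (SUP x\<in>A. INF y\<in>B. d x y)"
    by (rule cSUP_upper2[OF _ x])
      (use assms ge le in \<open>auto intro!: bdd_aboveI2[where M=1] cINF_greatest\<close>)
qed

lemma max_SUP_INF_eq_one:
  fixes d :: "'a \<Rightarrow> 'b \<Rightarrow> real"
  assumes nonneg: "\<And>x y. x \<in> A \<Longrightarrow> y \<in> B \<Longrightarrow> 0 \<le> d x y"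
    and a: "a \<in> A" and b: "b \<in> B"
    and le: "\<And>x. x \<in> A \<Longrightarrow> d x b \<le> 1" "\<And>y. y \<in> B \<Longrightarrow> d a y \<le> 1"
    and ge: "(\<exists>x\<in>A. \<forall>y\<in>B. 1 \<le> d x y) \<or> (\<exists>y\<in>B. \<forall>x\<in>A. 1 \<le> d x y)"
  shows "max (SUP x\<in>A. INF y\<in>B. d x y) (SUP y\<in>B. INF x\<in>A. d x y) = 1"
proof -
  note le_one = SUP_INF_le_one[of A B d, OF nonneg a b le(1)]
    SUP_INF_le_one[of B A "\<lambda>y x. d x y", OF nonneg b a le(2)]
  note ge_one = SUP_INF_ge_one[of A B d, OF nonneg a b le(1)]
    SUP_INF_ge_one[of B A "\<lambda>y x. d x y", OF nonneg b a le(2)]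
  from ge have "1 \<le> max (SUP x\<in>A. INF y\<in>B. d x y) (SUP y\<in>B. INF x\<in>A. d x y)"
    using ge_one by (auto simp: le_max_iff_disj)
  then show ?thesis using le_one by simp
qed

text \<open>Only the two inclusions and membership of 0 are assumed of P and Q, so that group
  algebras and von Neumann algebras are both instances.\<close>

lemma (in group) distances_eq_one:
  assumes H: "subgroup H G" and K: "subgroup K G" and "H \<noteq> K"
    and P: "P \<subseteq> commutant (carrier G) {ell2_proj (carrier G) H}" "op_zero \<in> P" "left_regular G ` H \<subseteq> P"
    and Q: "Q \<subseteq> commutant (carrier G) {ell2_proj (carrier G) K}" "op_zero \<in> Q" "left_regular G ` K \<subseteq> Q"
  shows "dist_C G P Q = 1 \<and> dist_MT G P Q = 1 \<and> dist_KK G P Q = 1"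
proof -
  let ?I = "carrier G"
  have Pb: "x \<in> bounded_ops ?I" if "x \<in> P" for x using that P(1) by (auto simp: commutant_def)
  have Qb: "x \<in> bounded_ops ?I" if "x \<in> Q" for x using that Q(1) by (auto simp: commutant_def)
  have z: "op_norm ?I op_zero \<le> 1"
    by (rule op_norm_least) (simp add: op_zero_def ell2_norm_zero)
  have zP: "op_zero \<in> unit_ball G P" and zQ: "op_zero \<in> unit_ball G Q"
    using P Q z by (auto simp: unit_ball_def)
  have op_diff_zero: "op_diff x op_zero = x" for x :: "'a operator"
    by (simp add: op_diff_def op_zero_def)
  have norm_le: "op_norm ?I (op_diff x op_zero) \<le> 1" "op_norm ?I (op_diff op_zero x) \<le> 1"
      "tau_norm G (op_diff x op_zero) \<le> 1" "tau_norm G (op_diff op_zero x) \<le> 1"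
    if "x \<in> unit_ball G P \<or> x \<in> unit_ball G Q" for x
  proof -
    have x: "x \<in> bounded_ops ?I" "op_norm ?I x \<le> 1"
      using that Pb Qb by (auto simp: unit_ball_def)
    then show "op_norm ?I (op_diff x op_zero) \<le> 1" "tau_norm G (op_diff x op_zero) \<le> 1"
      using tau_norm_le_op_norm[OF x(1)] by (simp_all add: op_diff_zero)
    then show "op_norm ?I (op_diff op_zero x) \<le> 1" "tau_norm G (op_diff op_zero x) \<le> 1"
      by (simp_all add: op_norm_diff_commute[of _ op_zero]
          tau_norm_diff_commute[OF op_zero_bounded x(1)])
  qed
  have d: "op_diff x y \<in> bounded_ops ?I" if "x \<in> P" "y \<in> Q" for x y
    using that by (simp add: op_diff_bounded Pb Qb)
  have nonneg: "0 \<le> tau_norm G (op_diff x y)" "tau_norm G (op_diff x y) \<le> op_norm ?I (op_diff x y)"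
    if "x \<in> P" "y \<in> Q" for x y
    using tau_norm_eq[OF d[OF that]] tau_norm_le_op_norm[OF d[OF that]]
    by (simp_all add: ell2_norm_nonneg)
  have lower: "(\<exists>x\<in>unit_ball G P. \<forall>y\<in>Q. 1 \<le> tau_norm G (op_diff x y)) \<or>
      (\<exists>y\<in>unit_ball G Q. \<forall>x\<in>P. 1 \<le> tau_norm G (op_diff x y))"
  proof (cases "H \<subseteq> K")
    case False
    then obtain g where g: "g \<in> H" "g \<notin> K" by blast
    have gG: "g \<in> ?I" using subgroup.mem_carrier[OF H g(1)] .
    have "left_regular G g \<in> unit_ball G P"
      using g P(3) left_regular_op_norm[OF gG] by (auto simp: unit_ball_def)
    then show ?thesis using tau_norm_left_regular_diff_ge[OF K gG g(2)] Q(1) by blast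
  \<comment> \<open>Here H is a proper subgroup of K, so the witness lies on the other side and the
    arguments of the trace norm have to be swapped.\<close>
  next
    case True
    with \<open>H \<noteq> K\<close> obtain g where g: "g \<in> K" "g \<notin> H" by blast
    have gG: "g \<in> ?I" using subgroup.mem_carrier[OF K g(1)] .
    have gQ: "left_regular G g \<in> unit_ball G Q"
      using g Q(3) left_regular_op_norm[OF gG] by (auto simp: unit_ball_def)
    have "1 \<le> tau_norm G (op_diff x (left_regular G g))" if "x \<in> P" for x
      using tau_norm_left_regular_diff_ge[OF H gG g(2), of x] P(1) that
        tau_norm_diff_commute[OF Pb[OF that] left_regular_bounded[OF gG]] by auto
    then show ?thesis using gQ by blast
  qed
  have sub: "unit_ball G P \<subseteq> P" "unit_ball G Q \<subseteq> Q" by (auto simp: unit_ball_def)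
  have lower': "(\<exists>x\<in>unit_ball G P. \<forall>y\<in>unit_ball G Q. 1 \<le> tau_norm G (op_diff x y)) \<or>
      (\<exists>y\<in>unit_ball G Q. \<forall>x\<in>unit_ball G P. 1 \<le> tau_norm G (op_diff x y))"
    using lower sub by blast
  have MT: "dist_MT G P Q = 1"
    unfolding dist_MT_def
    by (rule max_SUP_INF_eq_one[OF _ zP zQ _ _ lower']; use nonneg(1) sub norm_le in blast)
  \<comment> \<open>The operator norm dominates the trace norm, so the same witness serves.\<close>
  have lower_op: "(\<exists>x\<in>unit_ball G P. \<forall>y\<in>unit_ball G Q. 1 \<le> op_norm ?I (op_diff x y)) \<or>
      (\<exists>y\<in>unit_ball G Q. \<forall>x\<in>unit_ball G P. 1 \<le> op_norm ?I (op_diff x y))"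
    using lower' nonneg(2) sub by (meson order_trans subsetD)
  have nonneg_op: "0 \<le> op_norm ?I (op_diff x y)" if "x \<in> P" "y \<in> Q" for x y
    using nonneg[OF that] by linarith
  have KK: "dist_KK G P Q = 1"
    unfolding dist_KK_def
    by (rule max_SUP_INF_eq_one[OF _ zP zQ _ _ lower_op]; use nonneg_op sub norm_le in blast)
  have near1: "near_contained G 1 P Q" "near_contained G 1 Q P"
    unfolding near_contained_def using norm_le P(2) Q(2) by blast+
  have near_ge: "1 \<le> \<gamma>" if near: "near_contained G \<gamma> P Q" "near_contained G \<gamma> Q P" for \<gamma>
    using lower
  proof
    assume "\<exists>x\<in>unit_ball G P. \<forall>y\<in>Q. 1 \<le> tau_norm G (op_diff x y)"
    then show ?thesis using near(1) unfolding near_contained_def by (meson order_trans)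
  next
    assume "\<exists>y\<in>unit_ball G Q. \<forall>x\<in>P. 1 \<le> tau_norm G (op_diff x y)"
    then obtain y where y: "y \<in> unit_ball G Q" "\<And>x. x \<in> P \<Longrightarrow> 1 \<le> tau_norm G (op_diff x y)" by blast
    obtain x where x: "x \<in> P" "tau_norm G (op_diff y x) \<le> \<gamma>"
      using near(2) y(1) unfolding near_contained_def by blast
    then show ?thesis
      using y(2)[OF x(1)] tau_norm_diff_commute[OF Pb[OF x(1)] Qb, of y] y(1) sub by auto
  qed
  have "dist_C G P Q = 1"
    unfolding dist_C_def
    \<comment> \<open>The infimum is attained at 1, with the zero operator as approximant.\<close>
    by (rule cInf_eq_minimum) (use near1 near_ge in auto)
  with MT KK show ?thesis by simp
qed

section \<open>Both kinds of algebra lie in the commutant of the projection\<close>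

lemma (in group) left_regular_commutant_proj:
  assumes H: "subgroup H G"
  shows "left_regular G ` H \<subseteq> commutant (carrier G) {ell2_proj (carrier G) H}"
  using left_regular_proj_commute[OF H] left_regular_bounded subgroup.mem_carrier[OF H]
  by (auto simp: commutant_def)

lemma (in group) group_alg_properties:
  assumes H: "subgroup H G"
  shows "group_alg G H \<subseteq> commutant (carrier G) {ell2_proj (carrier G) H}"
    and "op_zero \<in> group_alg G H" and "left_regular G ` H \<subseteq> group_alg G H"
  unfolding group_alg_def star_algebra_generated_def
  using commutant_proj_star_subalgebra[of "carrier G" H] left_regular_commutant_proj[OF H]
  by (blast, auto simp: star_subalgebra_def)

lemma (in group) group_vN_properties:
  assumes H: "subgroup H G"
  shows "group_vN G H \<subseteq> commutant (carrier G) {ell2_proj (carrier G) H}"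
    and "op_zero \<in> group_vN G H" and "left_regular G ` H \<subseteq> group_vN G H"
proof -
  \<comment> \<open>The projection belongs to the first commutant of \<lambda>(H), so every element
    of the second commutant commutes with it.\<close>
  have "ell2_proj (carrier G) H \<in> commutant (carrier G) (left_regular G ` H)"
    using left_regular_proj_commute[OF H] by (auto simp: commutant_def ell2_proj_bounded)
  then show "group_vN G H \<subseteq> commutant (carrier G) {ell2_proj (carrier G) H}"
    unfolding group_vN_def commutant_def[of _ "commutant _ _"] commutant_def[of _ "{_}"] by blast
  show "op_zero \<in> group_vN G H"
    unfolding group_vN_def commutant_def
    by (auto simp: op_zero_bounded) (auto simp: op_zero_def bounded_ops_zero fun_eq_iff)
  show "left_regular G ` H \<subseteq> group_vN G H"
    using left_regular_bounded subgroup.mem_carrier[OF H]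
    by (auto simp: group_vN_def commutant_def)
qed

theorem proposition6p20:
  fixes G :: "('a, 'b) monoid_scheme" and H K :: "'a set"
  assumes "group G"
    and "subgroup H G" and "subgroup K G"
    and "H \<noteq> K"
    and "H \<noteq> {\<one>\<^bsub>G\<^esub>}" and "K \<noteq> {\<one>\<^bsub>G\<^esub>}"
  shows "dist_C G (group_alg G H) (group_alg G K) = 1
    \<and> dist_MT G (group_alg G H) (group_alg G K) = 1
    \<and> dist_KK G (group_alg G H) (group_alg G K) = 1
    \<and> dist_C G (group_vN G H) (group_vN G K) = 1
    \<and> dist_MT G (group_vN G H) (group_vN G K) = 1
    \<and> dist_KK G (group_vN G H) (group_vN G K) = 1"
proof -
  interpret group G by fact
  note HK = \<open>subgroup H G\<close> \<open>subgroup K G\<close>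
  show ?thesis
    using distances_eq_one[OF HK \<open>H \<noteq> K\<close> group_alg_properties[OF HK(1)] group_alg_properties[OF HK(2)]]
      distances_eq_one[OF HK \<open>H \<noteq> K\<close> group_vN_properties[OF HK(1)] group_vN_properties[OF HK(2)]]
    by blast
qed

end
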